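(* Let $p,q>0$ be real numbers and let $a_{2k-1} = \frac14 - p$, $a_{2k} = \frac14 + q$ for $k=1,2,\dots$. If there exist $\epsilon,\gamma\in(0,1)$ with $\epsilon<\gamma$ such that $$\epsilon\le \frac14 - p\le \gamma(1-\gamma)\quad\text{and}\quad \epsilon\le \frac14+q\le \gamma\left(1-\frac{\frac14-p}{1-\gamma}\right) = \gamma-\frac{\gamma}{1-\gamma}\left(\frac14-p\right),$$ then $\{a_n\}_{n=1}^{\infty}$ is a chain sequence and the series $\sum_{n=1}^{\infty}\left(a_n-\frac14\right)$ is divergent.
   Context: A sequence $\{a_n\}_{n=1}^{\infty}$ is called a chain sequence if there is a sequence $\{g_n\}_{n=0}^{\infty}$ (a parameter sequence) with $0\le g_n\le 1$ for all $n\ge 0$ such that $a_n = g_n(1-g_{n-1})$ for all $n\ge 1$. A series is divergent if its sequence of partial sums does not converge to a finite limit. *)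

theory Defs
  imports Complex_Main
begin

text \<open>
  Sequences indexed from 1 are functions on \<^typ>\<open>nat\<close> whose value at 0 is irrelevant;
  parameter sequences are indexed from 0.
\<close>

definition parameter_sequence :: "(nat \<Rightarrow> real) \<Rightarrow> (nat \<Rightarrow> real) \<Rightarrow> bool" where
  "parameter_sequence g a \<longleftrightarrow>
     (\<forall>n. 0 \<le> g n \<and> g n \<le> 1) \<and> (\<forall>n\<ge>1. a n = g n * (1 - g (n - 1)))"

definition chain_sequence :: "(nat \<Rightarrow> real) \<Rightarrow> bool" where
  "chain_sequence a \<longleftrightarrow> (\<exists>g. parameter_sequence g a)"

end

theory Submission
  imports Defs
begin

text \<open>
  The two upper bounds say that the sequence alternating between \<open>\<gamma>\<close> and \<open>(1/4 - p) / (1 - \<gamma>)\<close> is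
  a parameter sequence of a sequence dominating \<open>a\<close>: the odd terms agree, and the even terms are
  at least \<open>1/4 + q\<close>. A nonnegative sequence dominated in this way is itself a chain sequence
  (lemma \<open>chain_sequence_comparison\<close>). The series diverges because its terms of even index all
  equal \<open>q > 0\<close>, so they do not tend to 0.
\<close>

text \<open>
  Solving \<open>a n = g n * (1 - g (n - 1))\<close> successively for \<open>g n\<close> keeps \<open>g\<close> below \<open>M\<close>: if
  \<open>g (n - 1) \<le> M (n - 1)\<close>, then
  \<open>g n = a n / (1 - g (n - 1)) \<le> a n / (1 - M (n - 1)) \<le> M n\<close>. The strict bound \<open>M n < 1\<close> keeps
  the denominators positive.
\<close>

lemma chain_sequence_comparison:
  fixes a M :: "nat \<Rightarrow> real"
  assumes M: "\<And>n. 0 \<le> M n" "\<And>n. M n < 1"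
    and a: "\<And>n. 0 \<le> a (Suc n)" "\<And>n. a (Suc n) \<le> M (Suc n) * (1 - M n)"
  shows "chain_sequence a"
proof -
  define g where "g = rec_nat (0::real) (\<lambda>n x. a (Suc n) / (1 - x))"
  have g_Suc: "g (Suc n) = a (Suc n) / (1 - g n)" for n
    by (simp add: g_def)
  have bounds: "0 \<le> g n \<and> g n \<le> M n" for n
  proof (induction n)
    case 0
    show ?case using M(1) by (simp add: g_def)
  next
    case (Suc n)
    have "M (Suc n) * (1 - M n) \<le> M (Suc n) * (1 - g n)"
      using Suc M(1)[of "Suc n"] by (intro mult_left_mono) auto
    with a(2)[of n] have "a (Suc n) \<le> M (Suc n) * (1 - g n)"
      by linarith
    moreover have "0 < 1 - g n"
      using Suc M(2)[of n] by linarith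
    ultimately show ?case
      using a(1)[of n] by (simp add: g_Suc pos_divide_le_eq)
  qed
  have g_less: "g n < 1" for n
    using bounds[of n] M(2)[of n] by linarith
  have "a n = g n * (1 - g (n - 1))" if "n \<ge> 1" for n
  proof -
    obtain m where "n = Suc m"
      using \<open>n \<ge> 1\<close> by (cases n) auto
    then show ?thesis
      using g_less[of m] by (simp add: g_Suc)
  qed
  then have "parameter_sequence g a"
    unfolding parameter_sequence_def using bounds g_less by (auto intro: less_imp_le)
  then show ?thesis
    unfolding chain_sequence_def by blast
qed

theorem theorem2p5:
  fixes p q :: real and a :: "nat \<Rightarrow> real"
  assumes "p > 0" and "q > 0"
    and "\<And>k. k \<ge> 1 \<Longrightarrow> a (2 * k - 1) = 1 / 4 - p"
    and "\<And>k. k \<ge> 1 \<Longrightarrow> a (2 * k) = 1 / 4 + q"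
    and "\<exists>\<epsilon> \<gamma> :: real. \<epsilon> \<in> {0<..<1} \<and> \<gamma> \<in> {0<..<1} \<and> \<epsilon> < \<gamma> \<and>
           \<epsilon> \<le> 1 / 4 - p \<and> 1 / 4 - p \<le> \<gamma> * (1 - \<gamma>) \<and>
           \<epsilon> \<le> 1 / 4 + q \<and> 1 / 4 + q \<le> \<gamma> * (1 - (1 / 4 - p) / (1 - \<gamma>))"
  shows "chain_sequence a \<and> \<not> summable (\<lambda>n. a (Suc n) - 1 / 4)"
proof
  obtain \<epsilon> \<gamma> :: real where "0 < \<epsilon>" "\<epsilon> \<le> 1 / 4 - p" and \<gamma>: "0 < \<gamma>" "\<gamma> < 1"
    and odd_bound: "1 / 4 - p \<le> \<gamma> * (1 - \<gamma>)"
    and even_bound: "1 / 4 + q \<le> \<gamma> * (1 - (1 / 4 - p) / (1 - \<gamma>))"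
    using assms(5) unfolding greaterThanLessThan_iff by blast
  then have odd_pos: "0 < 1 / 4 - p"
    by linarith
  define \<beta> where "\<beta> = (1 / 4 - p) / (1 - \<gamma>)"
  have \<beta>: "0 \<le> \<beta>" "\<beta> \<le> \<gamma>" "\<beta> * (1 - \<gamma>) = 1 / 4 - p"
    using \<gamma> odd_pos odd_bound unfolding \<beta>_def by (simp_all add: pos_divide_le_eq)
  have a_odd: "a (Suc n) = 1 / 4 - p" if "even n" for n
    using that assms(3)[of "Suc (n div 2)"] by simp
  have a_even: "a (Suc n) = 1 / 4 + q" if "odd n" for n
    using that assms(4)[of "Suc n div 2"] by (cases n) auto
  show "chain_sequence a"
  proof (rule chain_sequence_comparison)
    fix n
    let ?M = "\<lambda>n::nat. if even n then \<gamma> else \<beta>"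
    show "0 \<le> ?M n" "?M n < 1"
      using \<gamma> \<beta>(1,2) by auto
    show "0 \<le> a (Suc n)"
      using a_odd[of n] a_even[of n] odd_pos assms(2) by (cases "even n") auto
    show "a (Suc n) \<le> ?M (Suc n) * (1 - ?M n)"
    proof (cases "even n")
      case True
      then have "?M (Suc n) * (1 - ?M n) = \<beta> * (1 - \<gamma>)" by simp
      with a_odd[OF True] \<beta>(3) show ?thesis by linarith
    next
      case False
      then have "?M (Suc n) * (1 - ?M n) = \<gamma> * (1 - \<beta>)" by simp
      with a_even[OF False] even_bound show ?thesis unfolding \<beta>_def by linarith
    qed
  qed
  show "\<not> summable (\<lambda>n. a (Suc n) - 1 / 4)"
  proof
    assume "summable (\<lambda>n. a (Suc n) - 1 / 4)"
    then have "(\<lambda>n. a (Suc n) - 1 / 4) \<longlonglongrightarrow> 0"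
      by (rule summable_LIMSEQ_zero)
    then have "((\<lambda>n. a (Suc n) - 1 / 4) \<circ> (\<lambda>k. 2 * k + 1)) \<longlonglongrightarrow> 0"
      by (rule LIMSEQ_subseq_LIMSEQ) (simp add: strict_mono_def)
    moreover have "(\<lambda>n. a (Suc n) - 1 / 4) \<circ> (\<lambda>k. 2 * k + 1) = (\<lambda>_. q)"
      by (simp add: fun_eq_iff a_even del: add_Suc_right add_Suc)
    ultimately have "q = 0"
      by (simp add: LIMSEQ_const_iff)
    with assms(2) show False
      by simp
  qed
qed

end
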